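(* Let $\Omega=\mathbb{R}\cup\{\infty\}$ and let $h_1,h_2$ be the Möbius transformations of $\Omega$ induced by the units $w=\sqrt{-2}+k$ and $u=1+(\sqrt{-2})i$, respectively. Let $a_1,a_2,b_1,b_2$ be real numbers such that the sets $$A_{1,1}:=[a_2,a_1],\quad A_{1,-1}:=[b_1,b_2],\quad A_{2,1}:=[-\infty,a_2[\ \cup\ ]b_2,\infty],\quad A_{2,-1}:=\,]a_1,b_1[$$ form a partition of $\Omega$ into non-empty sets. If $-a_2$ and $b_2$ are greater than $\sqrt{2}$ and $-a_1$ and $b_1$ are less than $\frac{1}{\sqrt{2}}$, then $h_1$ and $h_2$, with these sets, do not satisfy the conditions of the Ping-Pong Lemma.
   Context: For a field $K$, $\left(\frac{-1,-1}{K}\right)=K[i,j: i^2=-1,\ j^2=-1,\ -ji=ij=:k]$; here $K=\mathbb{Q}(\sqrt{-2})\subset\mathbb{C}$, $\sqrt{-2}=\sqrt{2}\sqrt{-1}$. For $v=v_1+v_ii+v_jj+v_kk$ put $$\Psi(v)=\begin{pmatrix} v_1+v_i\sqrt{-1} & v_j+v_k\sqrt{-1}\\ -v_j+v_k\sqrt{-1} & v_1-v_i\sqrt{-1}\end{pmatrix};$$ if $v$ is invertible, the Möbius transformation induced by $v$ is $z\mapsto\frac{m_{11}z+m_{12}}{m_{21}z+m_{22}}$ with $\Psi(v)=(m_{ij})$. Thus $h_1(z)=\frac{\sqrt2 z+1}{z+\sqrt2}$ and $h_2(z)=\frac{1-\sqrt2}{1+\sqrt2}z$. In $\Omega$ the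 symbols $-\infty$ and $\infty$ denote the same point, so $A_{2,1}=\{\infty\}\cup\{z\in\mathbb{R}: z<a_2 \text{ or } z>b_2\}$. The conditions of the Ping-Pong Lemma, for bijections $h_1,h_2$ of $\Omega$ and non-empty disjoint subsets $A_{1,1},A_{1,-1},A_{2,1},A_{2,-1}\subset\Omega$, are: $h_i^{\varepsilon}(\Omega\setminus A_{i,\varepsilon})\subset A_{i,-\varepsilon}$ for all $i\in\{1,2\}$ and $\varepsilon\in\{1,-1\}$. *)

theory Defs
  imports "HOL-Analysis.Analysis"
begin

section \<open>The quaternion algebra\<close>

datatype 'a quat = Quat (coeff_1: 'a) (coeff_i: 'a) (coeff_j: 'a) (coeff_k: 'a)

instantiation quat :: (comm_ring_1) ring_1
begin

definition zero_quat :: "'a quat" where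
  "0 = Quat 0 0 0 0"

definition one_quat :: "'a quat" where
  "1 = Quat 1 0 0 0"

definition plus_quat :: "'a quat \<Rightarrow> 'a quat \<Rightarrow> 'a quat" where
  "x + y = Quat (coeff_1 x + coeff_1 y) (coeff_i x + coeff_i y)
                (coeff_j x + coeff_j y) (coeff_k x + coeff_k y)"

definition uminus_quat :: "'a quat \<Rightarrow> 'a quat" where
  "- x = Quat (- coeff_1 x) (- coeff_i x) (- coeff_j x) (- coeff_k x)"

definition minus_quat :: "'a quat \<Rightarrow> 'a quat \<Rightarrow> 'a quat" where
  "x - y = Quat (coeff_1 x - coeff_1 y) (coeff_i x - coeff_i y)
                (coeff_j x - coeff_j y) (coeff_k x - coeff_k y)"

definition times_quat :: "'a quat \<Rightarrow> 'a quat \<Rightarrow> 'a quat" where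
  "x * y = Quat
     (coeff_1 x * coeff_1 y - coeff_i x * coeff_i y - coeff_j x * coeff_j y - coeff_k x * coeff_k y)
     (coeff_1 x * coeff_i y + coeff_i x * coeff_1 y + coeff_j x * coeff_k y - coeff_k x * coeff_j y)
     (coeff_1 x * coeff_j y - coeff_i x * coeff_k y + coeff_j x * coeff_1 y + coeff_k x * coeff_i y)
     (coeff_1 x * coeff_k y + coeff_i x * coeff_j y - coeff_j x * coeff_i y + coeff_k x * coeff_1 y)"

instance
  by standard
    (simp_all add: zero_quat_def one_quat_def plus_quat_def uminus_quat_def minus_quat_def
      times_quat_def algebra_simps)

end

definition quat_of :: "'a::comm_ring_1 \<Rightarrow> 'a quat" where
  "quat_of c = Quat c 0 0 0"

definition quat_i :: "'a::comm_ring_1 quat" where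
  "quat_i = Quat 0 1 0 0"

definition quat_j :: "'a::comm_ring_1 quat" where
  "quat_j = Quat 0 0 1 0"

definition quat_k :: "'a::comm_ring_1 quat" where
  "quat_k = Quat 0 0 0 1"

lemmas quat_defs = zero_quat_def one_quat_def plus_quat_def uminus_quat_def minus_quat_def
  times_quat_def quat_of_def quat_i_def quat_j_def quat_k_def

lemma quat_relations:
  "quat_i * quat_i = (-1 :: 'a::comm_ring_1 quat)"
  "quat_j * quat_j = (-1 :: 'a quat)"
  "quat_i * quat_j = (quat_k :: 'a quat)"
  "- (quat_j * quat_i) = (quat_k :: 'a quat)"
  by (simp_all add: quat_defs)

lemma quat_expansion:
  "Quat a b c d = quat_of a + quat_of b * quat_i + quat_of c * quat_j + quat_of d * quat_k"
  by (simp add: quat_defs)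

definition sqrt_m2 :: complex where
  "sqrt_m2 = complex_of_real (sqrt 2) * \<i>"

definition field_K :: "complex set" where
  "field_K = {of_rat a + of_rat b * sqrt_m2 | a b. True}"

definition quat_alg_K :: "complex quat set" where
  "quat_alg_K = {v. coeff_1 v \<in> field_K \<and> coeff_i v \<in> field_K \<and> coeff_j v \<in> field_K \<and> coeff_k v \<in> field_K}"

definition quat_units_K :: "complex quat set" where
  "quat_units_K = {v \<in> quat_alg_K. \<exists>v' \<in> quat_alg_K. v * v' = 1 \<and> v' * v = 1}"

definition unit_w :: "complex quat" where
  "unit_w = quat_of sqrt_m2 + quat_k"

definition unit_u :: "complex quat" where
  "unit_u = 1 + quat_of sqrt_m2 * quat_i"

section \<open>Induced Moebius transformations\<close>

definition Psi :: "complex quat \<Rightarrow> complex^2^2" where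
  "Psi v = vector
     [vector [coeff_1 v + coeff_i v * \<i>, coeff_j v + coeff_k v * \<i>],
      vector [- coeff_j v + coeff_k v * \<i>, coeff_1 v - coeff_i v * \<i>]]"

text \<open>The Riemann sphere is \<^typ>\<open>complex option\<close>, with \<^term>\<open>None\<close> as the point at infinity.
  The clauses below are meaningful for invertible matrices only.\<close>

fun moebius :: "complex^2^2 \<Rightarrow> complex option \<Rightarrow> complex option" where
  "moebius M None = (if M$2$1 = 0 then None else Some (M$1$1 / M$2$1))"
| "moebius M (Some z) =
     (if M$2$1 * z + M$2$2 = 0 then None
      else Some ((M$1$1 * z + M$1$2) / (M$2$1 * z + M$2$2)))"

definition induced_moebius :: "complex quat \<Rightarrow> complex option \<Rightarrow> complex option" where
  "induced_moebius v = moebius (Psi v)"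

definition real_pts :: "real set \<Rightarrow> complex option set" where
  "real_pts S = (\<lambda>x. Some (complex_of_real x)) ` S"

definition Omega :: "complex option set" where
  "Omega = insert None (real_pts UNIV)"

section \<open>The conditions of the Ping-Pong Lemma\<close>

text \<open>\<^term>\<open>h i\<close> is meant to be a bijection of \<^term>\<open>\<Omega>\<close>, so that \<^term>\<open>inv_into \<Omega> (h i)\<close> is
  its inverse there; see \<open>bij_betw_unit_w\<close> and \<open>bij_betw_unit_u\<close> below.\<close>

definition ping_pong_conditions ::
  "'a set \<Rightarrow> (nat \<Rightarrow> 'a \<Rightarrow> 'a) \<Rightarrow> (nat \<Rightarrow> int \<Rightarrow> 'a set) \<Rightarrow> bool" where
  "ping_pong_conditions \<Omega> h A \<longleftrightarrow>
     (\<forall>i\<in>{1, 2}. h i ` (\<Omega> - A i 1) \<subseteq> A i (-1) \<and> inv_into \<Omega> (h i) ` (\<Omega> - A i (-1)) \<subseteq> A i 1)"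

section \<open>The two units\<close>

lemma sqrt_m2_sq: "sqrt_m2 * sqrt_m2 = -2"
proof -
  have "sqrt_m2 * sqrt_m2 = complex_of_real (sqrt 2 * sqrt 2) * (\<i> * \<i>)"
    unfolding sqrt_m2_def of_real_mult by (simp only: mult_ac)
  then show ?thesis by simp
qed

lemma field_K_simps: "0 \<in> field_K" "1 \<in> field_K" "-1 \<in> field_K" "sqrt_m2 \<in> field_K" "- sqrt_m2 \<in> field_K"
proof -
  have *: "of_rat a + of_rat b * sqrt_m2 \<in> field_K" for a b
    by (auto simp: field_K_def)
  show "0 \<in> field_K" "1 \<in> field_K" "-1 \<in> field_K" "sqrt_m2 \<in> field_K" "- sqrt_m2 \<in> field_K"
    using *[of 0 0] *[of 1 0] *[of "-1" 0] *[of 0 1] *[of 0 "-1"] by (simp_all add: of_rat_minus)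
qed

lemma unit_w_in_units: "unit_w \<in> quat_units_K"
proof -
  have "unit_w * (quat_k - quat_of sqrt_m2) = 1" "(quat_k - quat_of sqrt_m2) * unit_w = 1"
    by (simp_all add: unit_w_def quat_defs sqrt_m2_sq)
  moreover have "unit_w \<in> quat_alg_K" "quat_k - quat_of sqrt_m2 \<in> quat_alg_K"
    by (simp_all add: unit_w_def quat_alg_K_def quat_defs field_K_simps)
  ultimately show ?thesis by (auto simp: quat_units_K_def)
qed

lemma unit_u_in_units: "unit_u \<in> quat_units_K"
proof -
  have "unit_u * (quat_of sqrt_m2 * quat_i - 1) = 1" "(quat_of sqrt_m2 * quat_i - 1) * unit_u = 1"
    by (simp_all add: unit_u_def quat_defs sqrt_m2_sq)
  moreover have "unit_u \<in> quat_alg_K" "quat_of sqrt_m2 * quat_i - 1 \<in> quat_alg_K"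
    by (simp_all add: unit_u_def quat_alg_K_def quat_defs field_K_simps)
  ultimately show ?thesis by (auto simp: quat_units_K_def)
qed

lemma sqrt_m2_mult_i: "sqrt_m2 * \<i> = - complex_of_real (sqrt 2)"
  by (simp add: sqrt_m2_def mult.assoc)

lemma Psi_unit_w:
  "Psi unit_w $ 1 $ 1 = \<i> * complex_of_real (sqrt 2)" "Psi unit_w $ 1 $ 2 = \<i>"
  "Psi unit_w $ 2 $ 1 = \<i>" "Psi unit_w $ 2 $ 2 = \<i> * complex_of_real (sqrt 2)"
  by (simp_all add: Psi_def unit_w_def quat_defs sqrt_m2_def)

lemma Psi_unit_u:
  "Psi unit_u $ 1 $ 1 = complex_of_real (1 - sqrt 2)" "Psi unit_u $ 1 $ 2 = 0"
  "Psi unit_u $ 2 $ 1 = 0" "Psi unit_u $ 2 $ 2 = complex_of_real (1 + sqrt 2)"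
  by (simp_all add: Psi_def unit_u_def quat_defs sqrt_m2_mult_i)

lemma induced_moebius_unit_w:
  "induced_moebius unit_w None = Some (complex_of_real (sqrt 2))"
  "induced_moebius unit_w (Some (complex_of_real x)) =
     (if x + sqrt 2 = 0 then None else Some (complex_of_real ((sqrt 2 * x + 1) / (x + sqrt 2))))"
proof -
  show "induced_moebius unit_w None = Some (complex_of_real (sqrt 2))"
    by (simp add: induced_moebius_def Psi_unit_w)
  have n: "\<i> * complex_of_real (sqrt 2) * complex_of_real x + \<i> = \<i> * complex_of_real (sqrt 2 * x + 1)"
    by (simp add: algebra_simps)
  have d: "\<i> * complex_of_real x + \<i> * complex_of_real (sqrt 2) = \<i> * complex_of_real (x + sqrt 2)"
    by (simp add: algebra_simps)
  show "induced_moebius unit_w (Some (complex_of_real x)) =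
     (if x + sqrt 2 = 0 then None else Some (complex_of_real ((sqrt 2 * x + 1) / (x + sqrt 2))))"
    unfolding induced_moebius_def moebius.simps Psi_unit_w n d mult_eq_0_iff of_real_eq_0_iff
    by (simp del: of_real_add of_real_mult add: of_real_divide)
qed

lemma induced_moebius_unit_u:
  "induced_moebius unit_u None = None"
  "induced_moebius unit_u (Some (complex_of_real x)) =
     Some (complex_of_real ((1 - sqrt 2) / (1 + sqrt 2) * x))"
proof -
  have "1 + sqrt 2 > 0" by (simp add: add_pos_nonneg)
  then have d: "complex_of_real (1 + sqrt 2) \<noteq> 0"
    unfolding of_real_eq_0_iff by linarith
  show "induced_moebius unit_u None = None"
    by (simp add: induced_moebius_def Psi_unit_u)
  show "induced_moebius unit_u (Some (complex_of_real x)) =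
     Some (complex_of_real ((1 - sqrt 2) / (1 + sqrt 2) * x))"
    unfolding induced_moebius_def moebius.simps Psi_unit_u using d by simp
qed

lemma bij_betw_unit_w: "bij_betw (induced_moebius unit_w) Omega Omega"
proof -
  define g where "g p = (case p of None \<Rightarrow> Some (complex_of_real (- sqrt 2))
     | Some z \<Rightarrow> (if Re z = sqrt 2 then None
                  else Some (complex_of_real ((sqrt 2 * Re z - 1) / (sqrt 2 - Re z)))))" for p
  show ?thesis
  proof (rule bij_betw_byWitness[where f' = g])
    show "\<forall>p\<in>Omega. g (induced_moebius unit_w p) = p"
    proof
      fix p assume "p \<in> Omega"
      then consider "p = None" | x where "p = Some (complex_of_real x)"
        by (auto simp: Omega_def real_pts_def)
      then show "g (induced_moebius unit_w p) = p"
      proof cases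
        case 1 then show ?thesis by (simp add: induced_moebius_unit_w g_def)
      next
        case (2 x)
        show ?thesis
        proof (cases "x + sqrt 2 = 0")
          case True
          then have "x = - sqrt 2" by linarith
          then show ?thesis
            using 2 induced_moebius_unit_w(2)[of x] by (simp add: g_def)
        next
          case False
          let ?y = "(sqrt 2 * x + 1) / (x + sqrt 2)"
          have 1: "sqrt 2 - ?y = 1 / (x + sqrt 2)"
            using False by (simp add: field_simps)
          have num: "sqrt 2 * ?y - 1 = x / (x + sqrt 2)"
            using False by (simp add: field_simps)
          have "?y \<noteq> sqrt 2"
            using 1 False by auto
          then have "g (Some (complex_of_real ?y)) =
              Some (complex_of_real ((sqrt 2 * ?y - 1) / (sqrt 2 - ?y)))"
            unfolding g_def option.case Re_complex_of_real by simp
          then show ?thesis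
            using 2 False induced_moebius_unit_w(2)[of x] unfolding 1 num by simp
        qed
      qed
    qed
    show "\<forall>p\<in>Omega. induced_moebius unit_w (g p) = p"
    proof
      fix p assume "p \<in> Omega"
      then consider "p = None" | x where "p = Some (complex_of_real x)"
        by (auto simp: Omega_def real_pts_def)
      then show "induced_moebius unit_w (g p) = p"
      proof cases
        case 1
        then have "g p = Some (complex_of_real (- sqrt 2))" by (simp add: g_def)
        then show ?thesis using 1 induced_moebius_unit_w(2)[of "- sqrt 2"] by simp
      next
        case (2 x)
        show ?thesis
        proof (cases "x = sqrt 2")
          case True
          then show ?thesis using 2 by (simp add: induced_moebius_unit_w g_def)
        next
          case False
          let ?y = "(sqrt 2 * x - 1) / (sqrt 2 - x)"
          have 1: "?y + sqrt 2 = 1 / (sqrt 2 - x)"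
            using False by (simp add: field_simps)
          have num: "sqrt 2 * ?y + 1 = x / (sqrt 2 - x)"
            using False by (simp add: field_simps)
          have g: "g p = Some (complex_of_real ?y)"
            using 2 False by (simp add: g_def)
          show ?thesis
            unfolding g induced_moebius_unit_w 1 num using 2 False by simp
        qed
      qed
    qed
    have mem: "None \<in> Omega" "Some (complex_of_real x) \<in> Omega" for x
      by (auto simp: Omega_def real_pts_def)
    have cases: "\<forall>p\<in>Omega. P p" if "P None" "\<And>x. P (Some (complex_of_real x))" for P
      using that by (auto simp: Omega_def real_pts_def)
    have "\<forall>p\<in>Omega. induced_moebius unit_w p \<in> Omega"
      by (rule cases) (simp_all only: induced_moebius_unit_w mem split: if_split, simp)
    then show "induced_moebius unit_w ` Omega \<subseteq> Omega" by blast
    have "\<forall>p\<in>Omega. g p \<in> Omega"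
      by (rule cases) (simp_all only: g_def option.case mem split: if_split, simp)
    then show "g ` Omega \<subseteq> Omega" by blast
  qed
qed

lemma bij_betw_unit_u: "bij_betw (induced_moebius unit_u) Omega Omega"
proof -
  define c where "c = (1 - sqrt 2) / (1 + sqrt 2)"
  have "1 + sqrt 2 > 0" by (simp add: add_pos_nonneg)
  then have c: "c \<noteq> 0" unfolding c_def by simp
  note u = induced_moebius_unit_u[folded c_def]
  show ?thesis
  proof (rule bij_betw_byWitness[where f' = "map_option (\<lambda>z. z / complex_of_real c)"])
    show "\<forall>p\<in>Omega. map_option (\<lambda>z. z / complex_of_real c) (induced_moebius unit_u p) = p"
      using c by (auto simp: Omega_def real_pts_def u)
    show "\<forall>p\<in>Omega. induced_moebius unit_u (map_option (\<lambda>z. z / complex_of_real c) p) = p"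
      using c by (auto simp: Omega_def real_pts_def u simp flip: of_real_divide)
    show "induced_moebius unit_u ` Omega \<subseteq> Omega"
      by (auto simp: Omega_def real_pts_def u simp del: of_real_mult)
    show "map_option (\<lambda>z. z / complex_of_real c) ` Omega \<subseteq> Omega"
      by (auto simp: Omega_def real_pts_def simp flip: of_real_divide)
  qed
qed

end

(*
  Put r = sqrt 2 and c = (r - 1) / (r + 1), so that h_2 z = - c z. The condition on h_2 gives
  c b_2 < - a_1 and - c a_2 < b_1. Letting points tend to a_1 and a_2 in the condition on h_1
  gives (r + a_1) (r - b_1) >= 1 and (- a_2 - r) (b_2 - r) >= 1. By AM-GM the first product
  forces b_1 - a_1 <= 2 (r - 1) and the second one b_2 - a_2 >= 2 (r + 1), hence
  2 (r - 1) <= c (b_2 - a_2) < b_1 - a_1 <= 2 (r - 1).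
*)

theory Submission imports Defs begin

lemma Some_of_real_in_real_pts [simp]: "Some (complex_of_real x) \<in> real_pts S \<longleftrightarrow> x \<in> S"
  by (auto simp: real_pts_def)

text \<open>The identity (x + y)^2 = 4 x y + (x - y)^2 gives (x + y)^2 \<ge> 4; positivity allows
  taking roots.\<close>

lemma sum_ge_2_of_mult_ge_1:
  fixes x y :: real
  assumes "0 < x" "0 < y" "1 \<le> x * y"
  shows "2 \<le> x + y"
proof -
  have "4 \<le> 4 * (x * y) + (x - y) * (x - y)"
    using assms(3) by (intro add_increasing2) auto
  also have "\<dots> = (x + y)\<^sup>2"
    by (simp add: power2_eq_square algebra_simps)
  finally have "2\<^sup>2 \<le> (x + y)\<^sup>2"
    by simp
  then show ?thesis
    by (rule power2_le_imp_le) (use assms in simp)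
qed

theorem proposition3p11:
  fixes a1 a2 b1 b2 :: real
    and h :: "nat \<Rightarrow> complex option \<Rightarrow> complex option"
    and A :: "nat \<Rightarrow> int \<Rightarrow> complex option set"
  assumes h1: "h 1 = induced_moebius unit_w"
    and h2: "h 2 = induced_moebius unit_u"
    and A11: "A 1 1 = real_pts {a2..a1}"
    and A1m: "A 1 (-1) = real_pts {b1..b2}"
    and A21: "A 2 1 = insert None (real_pts ({..<a2} \<union> {b2<..}))"
    and A2m: "A 2 (-1) = real_pts {a1<..<b1}"
    and nonempty: "\<forall>i\<in>{1, 2}. \<forall>e\<in>{1, -1}. A i e \<noteq> {}"
    and disjoint: "disjoint_family_on (\<lambda>(i, e). A i e) ({1, 2} \<times> {1, -1})"
    and cover: "(\<Union>i\<in>{1, 2}. \<Union>e\<in>{1, -1}. A i e) = Omega"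
    and "- a2 > sqrt 2" and "b2 > sqrt 2"
    and "- a1 < 1 / sqrt 2" and "b1 < 1 / sqrt 2"
  shows "\<not> ping_pong_conditions Omega h A"
proof
  assume pp: "ping_pong_conditions Omega h A"
  define r :: real where "r = sqrt 2"
  define c where "c = (r - 1) / (r + 1)"
  have r2: "r * r = 2" and r1: "1 < r"
    by (simp_all add: r_def)
  \<comment> \<open>Together with the bounds on \<open>a1\<close> and \<open>b1\<close>, this places
    the pole \<open>- r\<close> of h_1 to the left of \<open>a1\<close> and the value
    \<open>r\<close> of h_1 at infinity to the right of \<open>b1\<close>.\<close>
  then have inv_r: "1 / r < r"
    by (simp add: divide_less_eq)
  have a2: "a2 < - r" and b2: "r < b2" and a1: "- (1 / r) < a1" and b1: "b1 < 1 / r"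
    using assms(10-13) unfolding r_def by linarith+

  have ping: "h i (Some (complex_of_real x)) \<in> A i (-1)"
    if "i \<in> {1, 2}" "Some (complex_of_real x) \<notin> A i 1" for i x
  proof -
    have "h i ` (Omega - A i 1) \<subseteq> A i (-1)"
      using pp that(1) unfolding ping_pong_conditions_def by (simp only: Ball_def)
    moreover have "Some (complex_of_real x) \<in> Omega - A i 1"
      using that(2) by (simp add: Omega_def)
    ultimately show ?thesis
      by (rule subsetD[OF _ imageI])
  qed
  \<comment> \<open>h_1 increases on each side of its pole, so near \<open>a1\<close> from the right
    it is the lower end \<open>b1\<close> of the target interval that constrains.\<close>
  have b1_bounds: "b1 * (x + r) \<le> r * x + 1" if "a1 < x" for x
  proof -
    have pos: "0 < x + r"
      using that a1 inv_r by linarith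
    have "h 1 (Some (complex_of_real x)) \<in> A 1 (-1)"
      using that by (intro ping) (simp_all only: A11 Some_of_real_in_real_pts, simp_all)
    then have "Some (complex_of_real ((r * x + 1) / (x + r))) \<in> real_pts {b1..b2}"
      using pos unfolding h1 A1m induced_moebius_unit_w r_def[symmetric] by (simp only: split: if_splits)
    then have "b1 \<le> (r * x + 1) / (x + r)"
      unfolding Some_of_real_in_real_pts by simp
    then show ?thesis
      using pos by (simp add: pos_le_divide_eq)
  qed
  \<comment> \<open>To the left of the pole the constraint is the upper end \<open>b2\<close>; the
    negative denominator reverses the inequality.\<close>
  have b2_bounds: "b2 * (x + r) \<le> r * x + 1" if "x < a2" for x
  proof -
    have neg: "x + r < 0"
      using that a2 by linarith
    have "h 1 (Some (complex_of_real x)) \<in> A 1 (-1)"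
      using that by (intro ping) (simp_all only: A11 Some_of_real_in_real_pts, simp_all)
    then have "Some (complex_of_real ((r * x + 1) / (x + r))) \<in> real_pts {b1..b2}"
      using neg unfolding h1 A1m induced_moebius_unit_w r_def[symmetric] by (simp only: split: if_splits)
    then have "(r * x + 1) / (x + r) \<le> b2"
      unfolding Some_of_real_in_real_pts by simp
    then show ?thesis
      using neg by (simp add: neg_divide_le_eq)
  qed

  have "1 \<le> (r + a1) * (r - b1)"
  proof -
    have pos: "0 < r - b1"
      using b1 inv_r by linarith
    \<comment> \<open>The point \<open>a1\<close> itself lies in \<open>A 1 1\<close>, so the bound,
      solved for \<open>x\<close>, reaches it only as a limit from the right.\<close>
    have "(b1 * r - 1) / (r - b1) \<le> a1"
    proof (rule dense_ge)
      show "(b1 * r - 1) / (r - b1) \<le> x" if "a1 < x" for x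
        using b1_bounds[OF that] pos by (simp add: pos_divide_le_eq algebra_simps)
    qed
    \<comment> \<open>Add \<open>r * (r - b1)\<close>, which equals \<open>2 - r * b1\<close>, to
      both sides of the cleared inequality.\<close>
    then show ?thesis
      using pos r2 by (simp add: pos_divide_le_eq algebra_simps)
  qed
  moreover have "0 < r + a1" "0 < r - b1"
    using a1 b1 inv_r by linarith+
  ultimately have upper: "b1 - a1 \<le> 2 * (r - 1)"
    using sum_ge_2_of_mult_ge_1[of "r + a1" "r - b1"] by simp
  have "1 \<le> (- a2 - r) * (b2 - r)"
  proof -
    have "a2 \<le> (1 - b2 * r) / (b2 - r)"
    proof (rule dense_le)
      show "x \<le> (1 - b2 * r) / (b2 - r)" if "x < a2" for x
        using b2_bounds[OF that] b2 by (simp add: pos_le_divide_eq algebra_simps)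
    qed
    then show ?thesis
      using b2 r2 by (simp add: pos_le_divide_eq algebra_simps)
  qed
  then have lower: "2 * (r + 1) \<le> b2 - a2"
    using sum_ge_2_of_mult_ge_1[of "- a2 - r" "b2 - r"] a2 b2 by simp

  \<comment> \<open>The complement of \<open>A 2 1\<close> is closed, so both endpoints
    \<open>a2\<close> and \<open>b2\<close> are admissible without a limit.\<close>
  have contraction: "a1 < - (c * x) \<and> - (c * x) < b1" if "x \<in> {a2..b2}" for x
  proof -
    have c: "(1 - sqrt 2) / (1 + sqrt 2) = - c"
      unfolding c_def r_def by (metis add.commute minus_diff_eq minus_divide_left)
    have "h 2 (Some (complex_of_real x)) \<in> A 2 (-1)"
      using that by (intro ping) (simp_all add: A21)
    then have "- c * x \<in> {a1<..<b1}"
      unfolding h2 A2m induced_moebius_unit_u c Some_of_real_in_real_pts .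
    then show ?thesis by simp
  qed
  have c_pos: "0 < c"
    using r1 by (simp add: c_def)
  have "2 * (r - 1) = c * (2 * (r + 1))"
    using r1 by (simp add: c_def field_simps)
  also have "\<dots> \<le> c * (b2 - a2)"
    using lower c_pos by (intro mult_left_mono) auto
  \<comment> \<open>h_2 reverses order, so \<open>b2\<close> is compared with \<open>a1\<close> and
    \<open>a2\<close> with \<open>b1\<close>. The two AM-GM bounds match exactly; the contradiction
    rests on the strictness that comes from the open interval \<open>A 2 (-1)\<close>.\<close>
  also have "\<dots> < b1 - a1"
    using contraction[of a2] contraction[of b2] a2 b2 r1 by (simp add: algebra_simps)
  finally show False
    using upper by simp
qed

end
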